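(* For any two integers $s\geq 1$ and $t\geq 3$ there exists a constant $C_{s,t}$ such that for every positive integer $n$, $$\mathrm{ex}(n,L'_{s,t})\leq C_{s,t}\, n^{3/2-\frac{1}{4t-6}}.$$
   Context: For a graph $H$, $\mathrm{ex}(n,H)$ denotes the maximum number of edges in an $n$-vertex graph containing no subgraph isomorphic to $H$. The subdivision of a graph $L$ is the bipartite graph with parts $V(L)$ and $E(L)$ in which $v\in V(L)$ is adjacent to $e\in E(L)$ if and only if $v$ is an endpoint of $e$. For integers $s\geq 1$, $t\geq 3$, $L_{s,t}$ is the graph on vertex set $S\cup T$ with $S\cap T=\emptyset$, $|S|=s$, $|T|=t-1$, in which two distinct vertices $x,y$ are adjacent if and only if $x\in T$ or $y\in T$ (i.e. $K_{s+t-1}$ with the edges of a $K_s$ removed). $L'_{s,t}$ is the subdivision of $L_{s,t}$. *)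

theory Defs
  imports Complex_Main
begin

type_synonym 'a graph = "'a set \<times> 'a set set"

definition is_graph :: "'a graph \<Rightarrow> bool" where
  "is_graph G \<longleftrightarrow> finite (fst G) \<and> (\<forall>e\<in>snd G. e \<subseteq> fst G \<and> card e = 2)"

definition contains_copy :: "'a graph \<Rightarrow> 'b graph \<Rightarrow> bool" where
  "contains_copy G H \<longleftrightarrow>
     (\<exists>f. inj_on f (fst H) \<and> f ` fst H \<subseteq> fst G \<and> (\<forall>e\<in>snd H. f ` e \<in> snd G))"

definition ex :: "nat \<Rightarrow> 'b graph \<Rightarrow> nat" where
  "ex n H = Max {card E | E. is_graph ({0..<n}, E) \<and> \<not> contains_copy ({0..<n}, E) H}"

definition subdivision :: "'a graph \<Rightarrow> ('a + 'a set) graph" where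
  "subdivision L = (Inl ` fst L \<union> Inr ` snd L,
                    {{Inl v, Inr e} | v e. e \<in> snd L \<and> v \<in> e})"

text \<open>L_{s,t}: S = {0..<s}, T = {s..<s+t-1}; x,y adjacent iff distinct and one lies in T.\<close>
definition L_graph :: "nat \<Rightarrow> nat \<Rightarrow> nat graph" where
  "L_graph s t = ({0..<s+t-1},
     {{x, y} | x y. x \<in> {0..<s+t-1} \<and> y \<in> {0..<s+t-1} \<and> x \<noteq> y
                    \<and> (x \<in> {s..<s+t-1} \<or> y \<in> {s..<s+t-1})})"

definition L'_graph :: "nat \<Rightarrow> nat \<Rightarrow> (nat + nat set) graph" where
  "L'_graph s t = subdivision (L_graph s t)"

end

theory Submission
  imports Defs
begin

text \<open>
  Put \<alpha> = (t - 2) / (2 t - 3), so that the exponent is 1 + \<alpha>. Among all vertex sets W of a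
  graph with at least c n^(1+\<alpha>) edges take one maximising e(W) / |W|^(1+\<alpha>). Every subset of W is
  then sparse relative to W, so only few edges meet the vertices of very large degree; deleting
  these edges leaves a graph on m = |W| vertices with maximum degree at most a constant times
  \<delta>, where \<delta> is at least a constant times m^\<alpha>, and with linearly many vertices of degree at
  least \<delta>.

  Call two vertices heavy if they have many common neighbours and light if they have at least one
  but not many. A heavy clique on s + t - 1 vertices yields the subdivision greedily. If there is
  none, then by a Turan-type count a positive proportion of the pairs inside each neighbourhood are
  light, so every large set U of high-degree vertices contains a vertex with at least
  const * \<delta>^2 |U| / m light neighbours in U. Iterating this t - 1 times gives the part T and a set of
  common light neighbours that still has at least const * \<delta> vertices, from which S is chosen. At
  each step the vertices adjacent to a common neighbour of two chosen ones are discarded; this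
  costs only O(\<delta>) vertices and makes the connecting paths of length two disjoint.
\<close>

section \<open>Greedy selection and a Turan-type count of non-adjacent pairs\<close>

text \<open>A crude form of Hall's theorem: every \<open>F i\<close> has at least
  \<open>card I\<close> elements, and fewer than that are used up when \<open>i\<close> is treated,
  so a greedy choice never gets stuck.\<close>

lemma distinct_representatives:
  assumes "finite I" "\<And>i. i \<in> I \<Longrightarrow> finite (F i)" "\<And>i. i \<in> I \<Longrightarrow> card I \<le> card (F i)"
  shows "\<exists>g. inj_on g I \<and> (\<forall>i\<in>I. g i \<in> F i)"
proof -
  have "\<exists>g. inj_on g J \<and> (\<forall>i\<in>J. g i \<in> F i)" if "J \<subseteq> I" for J
    using finite_subset[OF that assms(1)] that
  proof (induction J rule: finite_induct)
    case empty
    then show ?case by simp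
  next
    case (insert i J)
    then obtain g where g: "inj_on g J" "\<forall>i\<in>J. g i \<in> F i"
      by auto
    have "card (g ` J) \<le> card J"
      using insert by (simp add: card_image_le)
    also have "\<dots> < card (insert i J)"
      using insert by simp
    also have "\<dots> \<le> card I"
      using insert.prems assms(1) by (rule card_mono[rotated])
    also have "\<dots> \<le> card (F i)"
      using assms(3) insert.prems by simp
    finally have "\<not> F i \<subseteq> g ` J"
      using insert.hyps by (meson card_mono finite_imageI not_le)
    then obtain b where b: "b \<in> F i" "b \<notin> g ` J"
      by auto
    have "inj_on (g(i := b)) (insert i J)"
      using g b insert.hyps by (auto simp: inj_on_def)
    moreover have "\<forall>j\<in>insert i J. (g(i := b)) j \<in> F j"
      using g b insert.hyps by auto
    ultimately show ?case
      by blast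
  qed
  then show ?thesis by blast
qed

text \<open>Pick any vertex and keep only its neighbours. By irreflexivity the vertex counts as its
  own non-neighbour, so a step costs fewer than \<open>q\<close> vertices, itself included.\<close>

lemma greedy_clique:
  fixes q :: real
  assumes "symp H" "irreflp H" "finite Y" "q > 0"
    and "\<And>y. y \<in> Y \<Longrightarrow> real (card {z \<in> Y. \<not> H y z}) < q"
    and "real k * q \<le> real (card Y)"
  shows "\<exists>Z\<subseteq>Y. card Z = k \<and> pairwise H Z"
  using assms(3,5,6)
proof (induction k arbitrary: Y)
  case 0
  then show ?case by (intro exI[of _ "{}"]) auto
next
  case (Suc k)
  have "0 < real (Suc k) * q"
    using \<open>q > 0\<close> by simp
  with Suc.prems have "card Y > 0"
    by linarith
  then obtain y where y: "y \<in> Y"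
    by (metis card_gt_0_iff ex_in_conv)
  define Y' where "Y' = {z \<in> Y. H y z}"
  have Y': "finite Y'" "Y' \<subseteq> Y"
    using Suc.prems by (auto simp: Y'_def)
  have "Y = Y' \<union> {z \<in> Y. \<not> H y z}"
    by (auto simp: Y'_def)
  then have "card Y \<le> card Y' + card {z \<in> Y. \<not> H y z}"
    by (metis card_Un_le)
  then have "real (card Y) \<le> real (card Y') + real (card {z \<in> Y. \<not> H y z})"
    by linarith
  then have "real k * q \<le> real (card Y')"
    using Suc.prems(2)[OF y] Suc.prems(3) by (simp add: algebra_simps)
  moreover have "real (card {w \<in> Y'. \<not> H z w}) < q" if "z \<in> Y'" for z
  proof -
    have "card {w \<in> Y'. \<not> H z w} \<le> card {w \<in> Y. \<not> H z w}"
      using Suc.prems(1) Y' by (intro card_mono) auto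
    then show ?thesis
      using Suc.prems(2)[of z] that Y' by force
  qed
  ultimately obtain Z where Z: "Z \<subseteq> Y'" "card Z = k" "pairwise H Z"
    using Suc.IH[OF Y'(1)] by blast
  have "y \<notin> Z"
    using Z(1) assms(2) by (auto simp: Y'_def irreflp_def)
  moreover have "finite Z"
    using Z(1) Y'(1) finite_subset by blast
  ultimately have "card (insert y Z) = Suc k"
    using Z(2) by simp
  moreover have "pairwise H (insert y Z)"
    using Z assms(1) by (auto simp: pairwise_insert Y'_def dest: sympD)
  ultimately show ?case
    using Z(1) Y' y by (intro exI[of _ "insert y Z"]) auto
qed

lemma card_pairs:
  assumes "finite X"
  shows "card {(x, y). x \<in> X \<and> y \<in> X \<and> P x y} = (\<Sum>x\<in>X. card {y \<in> X. P x y})"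
proof -
  have "{(x, y). x \<in> X \<and> y \<in> X \<and> P x y} = Sigma X (\<lambda>x. {y \<in> X. P x y})"
    by auto
  then show ?thesis
    using assms by simp
qed

text \<open>At most half of the vertices have fewer than \<open>q = card X / (2 * k)\<close>
  non-neighbours, since otherwise \<open>greedy_clique\<close> finds a clique among them; each of
  the others contributes at least \<open>q\<close> pairs. The pairs are ordered and include the
  diagonal.\<close>

lemma clique_free_nonadjacent:
  assumes "symp H" "irreflp H" "finite X" "k \<ge> 1"
    and no: "\<And>Z. Z \<subseteq> X \<Longrightarrow> card Z = k \<Longrightarrow> \<not> pairwise H Z"
  shows "(real (card X))\<^sup>2 / (4 * real k) \<le> real (card {(x, y). x \<in> X \<and> y \<in> X \<and> \<not> H x y})"
proof (cases "X = {}")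
  case True
  then show ?thesis by simp
next
  case False
  define q where "q = real (card X) / (2 * real k)"
  have q: "q > 0"
    using False assms(3,4) by (simp add: q_def card_gt_0_iff)
  define Y where "Y = {x \<in> X. real (card {z \<in> X. \<not> H x z}) < q}"
  have Y: "Y \<subseteq> X" "finite Y"
    using assms(3) by (auto simp: Y_def)
  have "real (card Y) < real (card X) / 2"
  proof (rule ccontr)
    assume "\<not> ?thesis"
    then have "real k * q \<le> real (card Y)"
      using assms(4) by (simp add: q_def)
    moreover have "real (card {z \<in> Y. \<not> H y z}) < q" if "y \<in> Y" for y
    proof -
      have "card {z \<in> Y. \<not> H y z} \<le> card {z \<in> X. \<not> H y z}"
        using assms(3) Y by (intro card_mono) auto
      then show ?thesis
        using that by (simp add: Y_def)
    qed
    ultimately obtain Z where "Z \<subseteq> Y" "card Z = k" "pairwise H Z"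
      using greedy_clique[OF assms(1,2) Y(2) q] by blast
    then show False
      using no Y by blast
  qed
  then have half: "real (card X) / 2 \<le> real (card (X - Y))"
    using Y by (simp add: card_Diff_subset card_mono assms(3) of_nat_diff)
  have "(real (card X))\<^sup>2 / (4 * real k) = real (card X) / 2 * q"
    by (simp add: q_def power2_eq_square)
  also have "\<dots> \<le> real (card (X - Y)) * q"
    using half q by (intro mult_right_mono) auto
  also have "\<dots> \<le> (\<Sum>x\<in>X - Y. real (card {z \<in> X. \<not> H x z}))"
  proof -
    have "q \<le> real (card {z \<in> X. \<not> H x z})" if "x \<in> X - Y" for x
      using that by (auto simp: Y_def)
    then show ?thesis
      using sum_mono[of "X - Y" "\<lambda>_. q"] by force
  qed
  also have "\<dots> \<le> (\<Sum>x\<in>X. real (card {z \<in> X. \<not> H x z}))"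
    using assms(3) by (intro sum_mono2) auto
  also have "\<dots> = real (card {(x, y). x \<in> X \<and> y \<in> X \<and> \<not> H x y})"
    using assms(3) by (simp add: card_pairs)
  finally show ?thesis .
qed

section \<open>Heavy and light pairs\<close>

text \<open>Graphs are handled as symmetric relations from here on: the image of a singleton is a
  neighbourhood, and \<open>card R\<close> counts each edge twice.\<close>

definition heavy :: "'a rel \<Rightarrow> nat \<Rightarrow> 'a \<Rightarrow> 'a \<Rightarrow> bool" where
  "heavy R M u v \<longleftrightarrow> u \<noteq> v \<and> M \<le> card (R `` {u} \<inter> R `` {v})"

text \<open>Non-emptiness later supplies the path of length two between \<open>u\<close> and
  \<open>v\<close>; the upper bound limits how many vertices the choice of such a pair rules
  out.\<close>

definition light :: "'a rel \<Rightarrow> nat \<Rightarrow> 'a \<Rightarrow> 'a \<Rightarrow> bool" where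
  "light R M u v \<longleftrightarrow> u \<noteq> v \<and> R `` {u} \<inter> R `` {v} \<noteq> {} \<and> card (R `` {u} \<inter> R `` {v}) < M"

lemma symp_heavy: "symp (heavy R M)"
  by (auto simp: symp_def heavy_def Int_commute)

lemma irreflp_heavy: "irreflp (heavy R M)"
  by (auto simp: irreflp_def heavy_def)

lemma light_sym: "light R M u v \<longleftrightarrow> light R M v u"
  by (auto simp: light_def Int_commute)

text \<open>Double counting of triples formed by a light ordered pair in \<open>U\<close> and a
  common neighbour \<open>b\<close>. No neighbourhood contains a heavy clique inside
  \<open>U\<close>, so each \<open>b\<close> sees many light pairs, and each light pair is counted
  fewer than \<open>M\<close> times; averaging over \<open>U\<close> gives \<open>u\<close>. The
  hypothesis \<open>large\<close> makes the mean of \<open>d b\<close> at least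
  \<open>8 * h\<close>, which renders the diagonal pairs harmless.\<close>

lemma exists_large_light_degree:
  fixes \<delta> :: real
  assumes "finite W" "R \<subseteq> W \<times> W" "sym R" "U \<subseteq> W" "U \<noteq> {}" "M > 0" "h \<ge> 1" "\<delta> \<ge> 0"
    and deg: "\<And>u. u \<in> U \<Longrightarrow> \<delta> \<le> real (card (R `` {u}))"
    and no: "\<And>Z. Z \<subseteq> U \<Longrightarrow> card Z = h \<Longrightarrow> \<not> pairwise (heavy R M) Z"
    and large: "8 * real h * real (card W) \<le> \<delta> * real (card U)"
  shows "\<exists>u\<in>U. \<delta>\<^sup>2 * real (card U) / (8 * real h * real M * real (card W))
                  \<le> real (card {v \<in> U. light R M u v})"
proof -
  have fin: "finite U" "finite R"
    using assms(1,2,4) by (auto intro: finite_subset)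
  have finN: "finite (R `` A)" for A
    using fin(2) by (auto intro: finite_subset[of _ "Range R"] simp: finite_Range)
  define m where "m = real (card W)"
  have m: "m > 0"
    using assms(1,4,5) by (auto simp: m_def card_gt_0_iff)
  define P where "P = {(x, y). x \<in> U \<and> y \<in> U \<and> light R M x y}"
  have finP: "finite P"
    using fin by (auto simp: P_def intro: finite_subset[of _ "U \<times> U"])
  define d where "d b = real (card (R `` {b} \<inter> U))" for b
  define S where "S = (\<Sum>b\<in>W. d b)"
  have "S = (\<Sum>b\<in>W. real (card {u \<in> U. (b, u) \<in> R}))"
    unfolding S_def d_def by (intro sum.cong refl arg_cong[where f=real] arg_cong[where f=card]) auto
  also have "\<dots> = (\<Sum>u\<in>U. real (card (R `` {u})))"
  proof -
    have "{b \<in> W. (b, u) \<in> R} = R `` {u}" for u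
      using assms(2,3) by (auto dest: symD)
    then show ?thesis
      using sum_multicount_gen[OF assms(1) fin(1), of "\<lambda>b u. (b, u) \<in> R" "\<lambda>u. card (R `` {u})"]
      by (simp flip: of_nat_sum)
  qed
  also have "\<dots> \<ge> (\<Sum>u\<in>U. \<delta>)"
    using deg by (intro sum_mono)
  finally have S: "\<delta> * real (card U) \<le> S"
    by (simp add: mult.commute)
  then have S8: "8 * real h * m \<le> S"
    using large by (simp add: m_def)
  \<comment> \<open>Two distinct neighbours of \<open>b\<close> that are not heavy are light,
    because \<open>b\<close> itself is a common neighbour. Subtracting \<open>d b\<close> removes
    the diagonal pairs.\<close>
  have pt: "(d b)\<^sup>2 / (4 * real h) - d b
      \<le> real (card {p \<in> P. (b, fst p) \<in> R \<and> (b, snd p) \<in> R})" for b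
  proof -
    let ?X = "R `` {b} \<inter> U"
    have "(d b)\<^sup>2 / (4 * real h) \<le> real (card {(x, y). x \<in> ?X \<and> y \<in> ?X \<and> \<not> heavy R M x y})"
      unfolding d_def
      by (rule clique_free_nonadjacent[OF symp_heavy irreflp_heavy]) (use fin assms no in auto)
    also have "{(x, y). x \<in> ?X \<and> y \<in> ?X \<and> \<not> heavy R M x y}
        \<subseteq> (\<lambda>x. (x, x)) ` ?X \<union> {p \<in> P. (b, fst p) \<in> R \<and> (b, snd p) \<in> R}"
      using assms(3) by (auto simp: P_def light_def heavy_def dest: symD)
    then have "card {(x, y). x \<in> ?X \<and> y \<in> ?X \<and> \<not> heavy R M x y}
        \<le> card ((\<lambda>x. (x, x)) ` ?X \<union> {p \<in> P. (b, fst p) \<in> R \<and> (b, snd p) \<in> R})"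
      using fin finP by (intro card_mono) auto
    also have "\<dots> \<le> card ((\<lambda>x. (x, x)) ` ?X) + card {p \<in> P. (b, fst p) \<in> R \<and> (b, snd p) \<in> R}"
      by (rule card_Un_le)
    also have "card ((\<lambda>x. (x, x)) ` ?X) = card ?X"
      by (intro card_image) (auto simp: inj_on_def)
    finally show ?thesis
      by (simp add: d_def)
  qed
  \<comment> \<open>Cauchy-Schwarz, from the squared deviations of \<open>d b\<close> from the mean
    \<open>S / m\<close>.\<close>
  have "S\<^sup>2 / m \<le> (\<Sum>b\<in>W. (d b)\<^sup>2)"
  proof -
    have "(\<Sum>b\<in>W. 2 * (S / m) * d b - (S / m)\<^sup>2) \<le> (\<Sum>b\<in>W. (d b)\<^sup>2)"
    proof (rule sum_mono)
      fix b
      have "0 \<le> (d b - S / m)\<^sup>2"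
        by simp
      then show "2 * (S / m) * d b - (S / m)\<^sup>2 \<le> (d b)\<^sup>2"
        by (simp add: power2_diff algebra_simps)
    qed
    moreover have "(\<Sum>b\<in>W. 2 * (S / m) * d b - (S / m)\<^sup>2) = 2 * (S / m) * S - m * (S / m)\<^sup>2"
    proof -
      have "(\<Sum>b\<in>W. 2 * (S / m) * d b) = 2 * (S / m) * S"
        unfolding S_def by (rule sum_distrib_left[symmetric])
      then show ?thesis
        by (simp add: sum_subtractf m_def)
    qed
    moreover have "2 * (S / m) * S - m * (S / m)\<^sup>2 = S\<^sup>2 / m"
      using m by (simp add: field_simps power2_eq_square)
    ultimately show ?thesis
      by simp
  qed
  then have "S\<^sup>2 / (4 * real h * m) - S \<le> (\<Sum>b\<in>W. (d b)\<^sup>2) / (4 * real h) - S"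
    using assms(7) by (simp add: field_simps)
  also have "\<dots> = (\<Sum>b\<in>W. (d b)\<^sup>2 / (4 * real h) - d b)"
    by (simp add: sum_subtractf S_def sum_divide_distrib)
  also have "\<dots> \<le> (\<Sum>b\<in>W. real (card {p \<in> P. (b, fst p) \<in> R \<and> (b, snd p) \<in> R}))"
    by (intro sum_mono pt)
  also have "\<dots> = (\<Sum>p\<in>P. real (card {b \<in> W. (b, fst p) \<in> R \<and> (b, snd p) \<in> R}))"
    using sum_multicount_gen[OF assms(1) finP, of "\<lambda>b p. (b, fst p) \<in> R \<and> (b, snd p) \<in> R"]
    by (simp flip: of_nat_sum)
  also have "\<dots> \<le> (\<Sum>p\<in>P. real M)"
  proof (rule sum_mono)
    fix p assume "p \<in> P"
    then obtain x y where p: "p = (x, y)" "light R M x y"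
      by (auto simp: P_def)
    have "{b \<in> W. (b, fst p) \<in> R \<and> (b, snd p) \<in> R} = R `` {x} \<inter> R `` {y}"
      using assms(2,3) by (auto simp: p dest: symD)
    then show "real (card {b \<in> W. (b, fst p) \<in> R \<and> (b, snd p) \<in> R}) \<le> real M"
      using p by (simp add: light_def)
  qed
  finally have 1: "S\<^sup>2 / (4 * real h * m) - S \<le> real (card P) * real M"
    by simp
  \<comment> \<open>By \<open>S8\<close> the linear term cancels at most half of the quadratic
    one.\<close>
  have "8 * real h * m * S \<le> S * S"
    using S8 S assms(8) by (intro mult_right_mono) (auto intro: order_trans[rotated])
  then have "S\<^sup>2 / (8 * real h * m) \<le> S\<^sup>2 / (4 * real h * m) - S"
    using m assms(7) by (simp add: field_simps power2_eq_square)
  with 1 have 2: "S\<^sup>2 / (8 * real h * m) \<le> real (card P) * real M"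
    by simp
  have "(\<delta> * real (card U))\<^sup>2 \<le> S\<^sup>2"
    using S assms(8) by (intro power_mono) auto
  then have "(\<delta> * real (card U))\<^sup>2 / (8 * real h * m) \<le> S\<^sup>2 / (8 * real h * m)"
    using m by (intro divide_right_mono) auto
  with 2 have 3: "(\<delta> * real (card U))\<^sup>2 / (8 * real h * m) \<le> real (card P) * real M"
    by simp
  show ?thesis
  proof (rule ccontr)
    assume "\<not> ?thesis"
    then have lt: "real (card {v \<in> U. light R M u v}) < \<delta>\<^sup>2 * real (card U) / (8 * real h * real M * m)"
      if "u \<in> U" for u
      using that by (auto simp: m_def not_le)
    have "real (card P) = (\<Sum>u\<in>U. real (card {v \<in> U. light R M u v}))"
      unfolding P_def using card_pairs[OF fin(1)] by simp
    also have "\<dots> < (\<Sum>u\<in>U. \<delta>\<^sup>2 * real (card U) / (8 * real h * real M * m))"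
      using lt fin assms(5) by (intro sum_strict_mono) auto
    also have "\<dots> = (\<delta> * real (card U))\<^sup>2 / (8 * real h * real M * m)"
      by (simp add: power2_eq_square)
    finally have "real (card P) * real M < (\<delta> * real (card U))\<^sup>2 / (8 * real h * real M * m) * real M"
      using assms(6) by (intro mult_strict_right_mono) auto
    also have "\<dots> = (\<delta> * real (card U))\<^sup>2 / (8 * real h * m)"
      using assms(6) by simp
    finally show False
      using 3 by simp
  qed
qed

section \<open>Passing to an almost regular subgraph\<close>

lemma card_rel_eq_sum:
  assumes "finite W" "R \<subseteq> W \<times> W"
  shows "card R = (\<Sum>v\<in>W. card (R `` {v}))"
proof -
  have R: "R = Sigma W (\<lambda>v. R `` {v})"
    using assms(2) by auto
  have "finite R"
    using assms by (auto intro: finite_subset)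
  then have "finite (R `` {v})" for v
    by (auto intro: finite_subset[of _ "Range R"] simp: finite_Range)
  then show ?thesis
    using assms(1) by (subst R) simp
qed

text \<open>The constant 648 makes the loss at most one half: pairs meeting the high-degree set
  \<open>D\<close> are covered by 648 sets of at most \<open>3 * m / 648\<close> vertices.
  Maximality of \<open>W\<close> bounds the pairs inside each, and the total is at most
  \<open>3 * (1 / 216) powr \<alpha>\<close> times \<open>P\<close>. Since
  \<open>1 / 3 \<le> \<alpha>\<close> and 216 is the cube of 6, this is at most
  \<open>P / 2\<close>.\<close>

lemma dense_almost_regular_subgraph:
  fixes \<alpha> c :: real
  assumes "finite V" "R \<subseteq> V \<times> V" "sym R" "V \<noteq> {}" and \<alpha>: "1/3 \<le> \<alpha>" and c: "648 \<le> c"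
    and dense: "c * real (card V) powr (1 + \<alpha>) \<le> real (card R)"
  obtains W R' A \<delta> where "finite W" "W \<noteq> {}" "R' \<subseteq> R" "R' \<subseteq> W \<times> W" "sym R'" "A \<subseteq> W"
    "c / 4 * real (card W) powr \<alpha> \<le> \<delta>" "\<And>v. real (card (R' `` {v})) \<le> 2592 * \<delta>"
    "\<And>v. v \<in> A \<Longrightarrow> \<delta> \<le> real (card (R' `` {v}))" "real (card W) \<le> 2592 * real (card A)"
proof -
  define F where "F W = real (card (R \<inter> W \<times> W)) / real (card W) powr (1 + \<alpha>)" for W
  have "finite {W. W \<subseteq> V \<and> W \<noteq> {}}" "{W. W \<subseteq> V \<and> W \<noteq> {}} \<noteq> {}"
    using assms(1,4) by auto
  then obtain W where "is_arg_min (\<lambda>W. - F W) (\<lambda>W. W \<in> {W. W \<subseteq> V \<and> W \<noteq> {}}) W"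
    using ex_is_arg_min_if_finite by blast
  then have W: "W \<subseteq> V" "W \<noteq> {}" and W_max: "\<And>X. X \<subseteq> V \<Longrightarrow> X \<noteq> {} \<Longrightarrow> F X \<le> F W"
    by (simp_all add: is_arg_min_linorder)
  have finR: "finite R"
    using assms(1,2) by (auto intro: finite_subset)
  have finN: "finite (R `` B)" for B
    using finR by (auto intro: finite_subset[of _ "Range R"] simp: finite_Range)
  have finW: "finite W"
    using W assms(1) finite_subset by blast
  define m where "m = real (card W)"
  define P where "P = real (card (R \<inter> W \<times> W))"
  define c' where "c' = F W"
  have m: "m \<ge> 1"
    using W finW by (simp add: m_def Suc_leI card_gt_0_iff)
  have P: "P = c' * m powr (1 + \<alpha>)"
    using m by (simp add: P_def c'_def F_def m_def)
  have "R \<inter> V \<times> V = R"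
    using assms(2) by blast
  then have "c \<le> F V"
    using dense assms(1,4) by (simp add: F_def field_simps card_gt_0_iff)
  then have c': "c \<le> c'"
    using W_max[of V] assms(4) by (simp add: c'_def)
  have hereditary: "real (card (R \<inter> X \<times> X)) \<le> c' * real (card X) powr (1 + \<alpha>)" if "X \<subseteq> V" for X
  proof (cases "X = {}")
    case False
    moreover have "finite X"
      using that assms(1) finite_subset by blast
    ultimately show ?thesis
      using W_max[OF that] by (simp add: F_def c'_def field_simps card_gt_0_iff)
  qed simp
  have mpow: "m powr (1 + \<alpha>) = m * m powr \<alpha>" "m powr \<alpha> \<ge> 1"
    using m \<alpha> by (simp_all add: powr_add ge_one_powr_ge_zero)
  have Ppos: "P > 0"
    using P c c' m by auto
  have "P \<le> m * m"
  proof -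
    have "card (R \<inter> W \<times> W) \<le> card (W \<times> W)"
      using finW by (intro card_mono) auto
    then show ?thesis
      by (simp add: P_def m_def card_cartesian_product flip: of_nat_mult)
  qed
  \<comment> \<open>From \<open>c' * m powr (1 + \<alpha>) = P \<le> m * m\<close> one gets
    \<open>c' \<le> m\<close>. The bound pays for the rounding term 1 in the class sizes
    below.\<close>
  have m648: "648 \<le> m"
  proof (rule ccontr)
    assume "\<not> 648 \<le> m"
    then have "m < c'"
      using c c' by simp
    then have "m * m < c' * m"
      using m by simp
    also have "\<dots> \<le> c' * (m * m powr \<alpha>)"
      using m mpow(2) c c' by (intro mult_left_mono) auto
    finally show False
      using \<open>P \<le> m * m\<close> P mpow by simp
  qed
  define D where "D = {v \<in> W. 648 * P / m \<le> real (card ((R \<inter> W \<times> W) `` {v}))}"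
  have finD: "finite D" "D \<subseteq> W"
    using finW by (auto simp: D_def)
  have "real (card D) * (648 * P / m) = (\<Sum>v\<in>D. 648 * P / m)"
    by simp
  also have "\<dots> \<le> (\<Sum>v\<in>D. real (card ((R \<inter> W \<times> W) `` {v})))"
    by (intro sum_mono) (simp add: D_def)
  also have "\<dots> \<le> (\<Sum>v\<in>W. real (card ((R \<inter> W \<times> W) `` {v})))"
    using finW finD by (intro sum_mono2) auto
  also have "\<dots> = P"
    using card_rel_eq_sum[OF finW, of "R \<inter> W \<times> W"] by (simp add: P_def)
  finally have cardD: "real (card D) \<le> m / 648"
    using Ppos m by (simp add: field_simps)
  \<comment> \<open>Numbering \<open>W\<close> and reducing modulo 648 splits it into nearly equal
    classes \<open>Y j\<close>.\<close>
  obtain idx where idx: "bij_betw idx W {0..<card W}"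
    using ex_bij_betw_finite_nat[OF finW] by blast
  define Y where "Y j = {v \<in> W. idx v mod 648 = j}" for j :: nat
  have cardY: "real (card (Y j)) \<le> m / 648 + 1" for j
  proof -
    have "inj_on (\<lambda>v. idx v div 648) (Y j)"
    proof (rule inj_onI)
      fix x y assume "x \<in> Y j" "y \<in> Y j" "idx x div 648 = idx y div 648"
      then have "idx x = idx y" "x \<in> W" "y \<in> W"
        by (auto simp: Y_def) (metis div_mult_mod_eq)
      then show "x = y"
        using idx by (auto simp: bij_betw_def inj_on_def)
    qed
    moreover have "(\<lambda>v. idx v div 648) ` Y j \<subseteq> {..card W div 648}"
    proof
      fix i assume "i \<in> (\<lambda>v. idx v div 648) ` Y j"
      then obtain v where v: "i = idx v div 648" "v \<in> W"
        by (auto simp: Y_def)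
      then have "idx v < card W"
        using bij_betwE[OF idx] by auto
      then show "i \<in> {..card W div 648}"
        using v by (simp add: div_le_mono)
    qed
    ultimately have "card (Y j) \<le> card {..card W div 648}"
      by (intro card_inj_on_le) auto
    then have "real (card (Y j)) \<le> real (card W div 648) + 1"
      by simp
    also have "real (card W div 648) \<le> m / 648"
      using of_nat_mono[OF times_div_less_eq_dividend[of 648 "card W"], where 'a = real] by (simp add: m_def)
    finally show ?thesis
      by simp
  qed
  \<comment> \<open>A pair meeting \<open>D\<close> has one end in \<open>D\<close> and the other in
    some class \<open>Y j\<close>, so it lies inside \<open>D \<union> Y j\<close>.\<close>
  define B where "B = {(x, y). (x, y) \<in> R \<inter> W \<times> W \<and> (x \<in> D \<or> y \<in> D)}"
  have "B \<subseteq> (\<Union>j<648. R \<inter> (D \<union> Y j) \<times> (D \<union> Y j))"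
  proof
    fix p assume "p \<in> B"
    then obtain x y where p: "p = (x, y)" "(x, y) \<in> R" "x \<in> W" "y \<in> W" "x \<in> D \<or> y \<in> D"
      by (auto simp: B_def)
    from p(5) show "p \<in> (\<Union>j<648. R \<inter> (D \<union> Y j) \<times> (D \<union> Y j))"
    proof
      assume "x \<in> D"
      then show ?thesis
        using p by (intro UN_I[of "idx y mod 648"]) (auto simp: Y_def)
    next
      assume "y \<in> D"
      then show ?thesis
        using p by (intro UN_I[of "idx x mod 648"]) (auto simp: Y_def)
    qed
  qed
  then have "card B \<le> card (\<Union>j<648. R \<inter> (D \<union> Y j) \<times> (D \<union> Y j))"
    using finR by (intro card_mono) auto
  also have "\<dots> \<le> (\<Sum>j<648. card (R \<inter> (D \<union> Y j) \<times> (D \<union> Y j)))"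
    by (rule card_UN_le) simp
  finally have "real (card B) \<le> (\<Sum>j<648. real (card (R \<inter> (D \<union> Y j) \<times> (D \<union> Y j))))"
    by (simp flip: of_nat_sum)
  also have "\<dots> \<le> (\<Sum>j<(648::nat). P * (3 / 648) powr (1 + \<alpha>))"
  proof (rule sum_mono)
    fix j
    have "real (card (D \<union> Y j)) \<le> real (card D) + real (card (Y j))"
      using card_Un_le[of D "Y j"] by linarith
    also have "\<dots> \<le> m / 648 + (m / 648 + 1)"
      using cardD cardY by (intro add_mono)
    also have "\<dots> \<le> m * (3 / 648)"
      using m648 by simp
    finally have size: "real (card (D \<union> Y j)) \<le> m * (3 / 648)" .
    have "real (card (R \<inter> (D \<union> Y j) \<times> (D \<union> Y j))) \<le> c' * real (card (D \<union> Y j)) powr (1 + \<alpha>)"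
      using finD W by (intro hereditary) (auto simp: Y_def)
    also have "\<dots> \<le> c' * (m * (3 / 648)) powr (1 + \<alpha>)"
      using size c c' \<alpha> by (intro mult_left_mono powr_mono2) auto
    also have "\<dots> = P * (3 / 648) powr (1 + \<alpha>)"
      using m by (subst powr_mult) (auto simp: P)
    finally show "real (card (R \<inter> (D \<union> Y j) \<times> (D \<union> Y j))) \<le> P * (3 / 648) powr (1 + \<alpha>)" .
  qed
  also have "\<dots> = P * (3 * (1 / 216) powr \<alpha>)"
    by (simp add: powr_add)
  also have "\<dots> \<le> P * (3 * (1 / 6))"
  proof -
    have "(1 / 216 :: real) powr \<alpha> \<le> (1 / 216) powr (1 / 3)"
      using \<alpha> by (intro powr_mono') auto
    also have "(1 / 216 :: real) powr (1 / 3) = ((1 / 6) powr 3) powr (1 / 3)"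
      by (simp add: power_divide)
    also have "\<dots> = 1 / 6"
      unfolding powr_powr by simp
    finally show ?thesis
      using Ppos by (intro mult_left_mono) auto
  qed
  finally have cardB: "real (card B) \<le> P / 2"
    by simp
  define R' where "R' = R \<inter> W \<times> W - B"
  \<comment> \<open>A quarter of the average degree \<open>P / m\<close>, so that the degree cut-off
    \<open>648 * P / m\<close> equals \<open>2592 * \<delta>\<close>.\<close>
  define \<delta> where "\<delta> = P / (4 * m)"
  define A where "A = {v \<in> W. \<delta> \<le> real (card (R' `` {v}))}"
  have "B \<subseteq> R \<inter> W \<times> W"
    by (auto simp: B_def)
  then have "real (card R') = P - real (card B)"
    using finR finite_subset[of B R] card_mono[of "R \<inter> W \<times> W" B]
    by (simp add: R'_def P_def card_Diff_subset of_nat_diff)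
  then have cardR': "P / 2 \<le> real (card R')"
    using cardB by simp
  have maxdeg: "real (card (R' `` {v})) \<le> 648 * P / m" for v
  proof (cases "v \<in> W - D")
    case True
    have "R' `` {v} \<subseteq> (R \<inter> W \<times> W) `` {v}"
      by (auto simp: R'_def)
    then have "card (R' `` {v}) \<le> card ((R \<inter> W \<times> W) `` {v})"
      using finN[of "{v}"] by (intro card_mono) (auto intro: finite_subset[rotated])
    then show ?thesis
      using True by (auto simp: D_def)
  next
    case False
    then have "R' `` {v} = {}"
      by (auto simp: R'_def B_def)
    then show ?thesis
      using Ppos m by simp
  qed
  have A: "A \<subseteq> W" "finite A"
    using finW by (auto simp: A_def)
  \<comment> \<open>At least \<open>P / 2\<close> pairs survive and vertices outside
    \<open>A\<close> account for at most \<open>P / 4\<close> of them. The rest starts in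
    \<open>A\<close>, and the maximum degree forces \<open>A\<close> to have linear size.\<close>
  have "real (card R') = (\<Sum>v\<in>W. real (card (R' `` {v})))"
    using card_rel_eq_sum[OF finW, of R'] by (simp add: R'_def le_infI2 Diff_subset subset_trans[OF Diff_subset])
  also have "\<dots> = (\<Sum>v\<in>W - A. real (card (R' `` {v}))) + (\<Sum>v\<in>A. real (card (R' `` {v})))"
    using A finW by (intro sum.subset_diff)
  also have "\<dots> \<le> (\<Sum>v\<in>W - A. \<delta>) + (\<Sum>v\<in>A. 648 * P / m)"
    using maxdeg by (intro add_mono sum_mono) (auto simp: A_def)
  also have "(\<Sum>v\<in>W - A. \<delta>) \<le> (\<Sum>v\<in>W. \<delta>)"
    using finW Ppos m by (intro sum_mono2) (auto simp: \<delta>_def)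
  also have "\<dots> = P / 4"
    using m by (simp add: \<delta>_def m_def[symmetric])
  finally have "P / 4 \<le> real (card A) * (648 * P / m)"
    using cardR' by simp
  then have "real (card W) \<le> 2592 * real (card A)"
    using Ppos m by (simp add: field_simps flip: m_def)
  moreover have "c / 4 * real (card W) powr \<alpha> \<le> \<delta>"
    using m c' by (simp add: \<delta>_def P mpow flip: m_def)
  moreover have "real (card (R' `` {v})) \<le> 2592 * \<delta>" for v
    using maxdeg[of v] by (simp add: \<delta>_def)
  moreover have "sym R'"
    using assms(3) by (auto simp: R'_def B_def sym_def)
  moreover have "R' \<subseteq> R" "R' \<subseteq> W \<times> W"
    by (auto simp: R'_def)
  moreover have "\<delta> \<le> real (card (R' `` {v}))" if "v \<in> A" for v
    using that by (simp add: A_def)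
  ultimately show ?thesis
    using that[of W R' A \<delta>] finW W A by blast
qed

section \<open>Embedding the subdivision of L_{s,t}\<close>

text \<open>A copy of the subdivision of \<open>L\<close>, with separate injections \<open>f\<close>
  for the branch vertices and \<open>g\<close> for the subdivision vertices in place of one
  injection on the sum type.\<close>

definition has_subdivision :: "'a rel \<Rightarrow> 'b graph \<Rightarrow> bool" where
  "has_subdivision R L \<longleftrightarrow> (\<exists>f g. inj_on f (fst L) \<and> inj_on g (snd L) \<and>
     (\<forall>e\<in>snd L. g e \<notin> f ` fst L \<and> (\<forall>v\<in>e. (f v, g e) \<in> R)))"

lemma has_subdivision_mono:
  assumes "has_subdivision R L" "R \<subseteq> R'"
  shows "has_subdivision R' L"
proof -
  obtain f g where "inj_on f (fst L)" "inj_on g (snd L)"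
    "\<forall>e\<in>snd L. g e \<notin> f ` fst L \<and> (\<forall>v\<in>e. (f v, g e) \<in> R)"
    using assms(1) unfolding has_subdivision_def by (elim exE conjE)
  then show ?thesis
    unfolding has_subdivision_def using assms(2) by (intro exI[of _ f] exI[of _ g]) auto
qed

text \<open>The two injections combine to \<open>case_sum f g\<close>. As
  \<open>has_subdivision\<close> does not mention \<open>V\<close>, that the images lie in
  \<open>V\<close> is read off from edges: every branch vertex lies in an edge of \<open>L\<close>,
  and every edge of \<open>L\<close> has an end.\<close>

lemma has_subdivision_imp_contains_copy:
  assumes "is_graph (V, E)" "has_subdivision {(x, y). {x, y} \<in> E} L"
    and "fst L \<subseteq> \<Union>(snd L)" "\<And>e. e \<in> snd L \<Longrightarrow> e \<noteq> {} \<and> e \<subseteq> fst L"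
  shows "contains_copy (V, E) (subdivision L)"
proof -
  obtain f g where f: "inj_on f (fst L)" and g: "inj_on g (snd L)"
    and disj: "\<And>e. e \<in> snd L \<Longrightarrow> g e \<notin> f ` fst L"
    and adj: "\<And>e v. e \<in> snd L \<Longrightarrow> v \<in> e \<Longrightarrow> {f v, g e} \<in> E"
  proof -
    obtain f g where "inj_on f (fst L)" "inj_on g (snd L)"
      and *: "\<forall>e\<in>snd L. g e \<notin> f ` fst L \<and> (\<forall>v\<in>e. (f v, g e) \<in> {(x, y). {x, y} \<in> E})"
      using assms(2) unfolding has_subdivision_def by (elim exE conjE)
    moreover have "{f v, g e} \<in> E" if "e \<in> snd L" "v \<in> e" for e v
      using bspec[OF * that(1)] that(2) by simp
    ultimately show ?thesis
      using that[of f g] by simp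
  qed
  have V: "e \<subseteq> V" if "e \<in> E" for e
    using that assms(1) by (auto simp: is_graph_def)
  have "f v \<in> V" if "v \<in> fst L" for v
  proof -
    obtain e where "e \<in> snd L" "v \<in> e"
      using \<open>v \<in> fst L\<close> assms(3) by blast
    from V[OF adj[OF this]] show ?thesis
      by simp
  qed
  moreover have "g e \<in> V" if "e \<in> snd L" for e
  proof -
    obtain v where "v \<in> e"
      using assms(4)[OF \<open>e \<in> snd L\<close>] by blast
    from V[OF adj[OF \<open>e \<in> snd L\<close> this]] show ?thesis
      by simp
  qed
  ultimately have "case_sum f g ` (Inl ` fst L \<union> Inr ` snd L) \<subseteq> V"
    by auto
  moreover have "inj_on (case_sum f g) (Inl ` fst L \<union> Inr ` snd L)"
  proof -
    have "inj_on (case_sum f g) (Inl ` fst L)" "inj_on (case_sum f g) (Inr ` snd L)"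
      using f g by (auto intro!: inj_onI dest: inj_onD)
    moreover have "case_sum f g ` (Inl ` fst L) \<inter> case_sum f g ` (Inr ` snd L) = {}"
      using disj by (fastforce simp: image_iff)
    ultimately show ?thesis
      unfolding inj_on_Un by blast
  qed
  moreover have "case_sum f g ` d \<in> E" if "d \<in> snd (subdivision L)" for d
  proof -
    obtain v e where "d = {Inl v, Inr e}" "e \<in> snd L" "v \<in> e"
      using \<open>d \<in> snd (subdivision L)\<close> unfolding subdivision_def snd_conv by blast
    then show ?thesis
      using adj by simp
  qed
  moreover have "fst (subdivision L) = Inl ` fst L \<union> Inr ` snd L"
    by (simp add: subdivision_def)
  ultimately show ?thesis
    unfolding contains_copy_def fst_conv snd_conv
    by (intro exI[of _ "case_sum f g"] conjI ballI) simp_all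
qed

lemma L_graph_edge_iff:
  "e \<in> snd (L_graph s t) \<longleftrightarrow>
     (\<exists>i j. e = {i, j} \<and> i \<in> {s..<s+t-1} \<and> j \<in> {0..<s+t-1} \<and> i \<noteq> j)"
proof
  assume "e \<in> snd (L_graph s t)"
  then obtain x y where "e = {x, y}" "x \<in> {0..<s+t-1}" "y \<in> {0..<s+t-1}" "x \<noteq> y"
    "x \<in> {s..<s+t-1} \<or> y \<in> {s..<s+t-1}"
    unfolding L_graph_def snd_conv by blast
  then show "\<exists>i j. e = {i, j} \<and> i \<in> {s..<s+t-1} \<and> j \<in> {0..<s+t-1} \<and> i \<noteq> j"
    by (metis insert_commute)
next
  assume "\<exists>i j. e = {i, j} \<and> i \<in> {s..<s+t-1} \<and> j \<in> {0..<s+t-1} \<and> i \<noteq> j"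
  then show "e \<in> snd (L_graph s t)"
    unfolding L_graph_def snd_conv by force
qed

lemma fst_L_graph: "fst (L_graph s t) = {0..<s+t-1}"
  by (simp add: L_graph_def)

lemma L_graph_edge_ne:
  assumes "e \<in> snd (L_graph s t)"
  shows "e \<noteq> {} \<and> e \<subseteq> fst (L_graph s t)"
  using assms by (auto simp: L_graph_edge_iff fst_L_graph)

lemma L_graph_no_isolated:
  assumes "t \<ge> 3"
  shows "fst (L_graph s t) \<subseteq> \<Union>(snd (L_graph s t))"
proof
  fix j assume j: "j \<in> fst (L_graph s t)"
  \<comment> \<open>Since \<open>t \<ge> 3\<close>, the part T has two vertices \<open>s\<close> and
    \<open>Suc s\<close>, one of which differs from \<open>j\<close>.\<close>
  define i where "i = (if j = s then Suc s else s)"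
  have "{i, j} \<in> snd (L_graph s t)"
    unfolding L_graph_edge_iff
    by (intro exI[of _ i] exI[of _ j]) (use j assms in \<open>auto simp: i_def fst_L_graph\<close>)
  then show "j \<in> \<Union>(snd (L_graph s t))"
    by blast
qed

lemma finite_L_graph_edges: "finite (snd (L_graph s t))"
  and card_L_graph_edges: "card (snd (L_graph s t)) \<le> (s+t-1) * (s+t-1)"
proof -
  have sub: "snd (L_graph s t) \<subseteq> (\<lambda>(i, j). {i, j}) ` ({0..<s+t-1} \<times> {0..<s+t-1})"
    by (auto simp: L_graph_def)
  show "finite (snd (L_graph s t))"
    by (rule finite_subset[OF sub]) auto
  have "card (snd (L_graph s t)) \<le> card ((\<lambda>(i, j). {i, j}) ` ({0..<s+t-1} \<times> {0..<s+t-1}))"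
    by (rule card_mono[OF _ sub]) auto
  also have "\<dots> \<le> card ({0..<s+t-1} \<times> {0..<s+t-1})"
    by (rule card_image_le) auto
  finally show "card (snd (L_graph s t)) \<le> (s+t-1) * (s+t-1)"
    by (simp add: card_cartesian_product)
qed

text \<open>With \<open>h = s + t - 1\<close>, each pair in \<open>Z\<close> has at least
  \<open>h * h + h\<close> common neighbours. Removing \<open>Z\<close> leaves at least
  \<open>h * h\<close>, no fewer than the edges of L_{s,t}, so distinct subdivision vertices off
  \<open>Z\<close> exist.\<close>

lemma heavy_clique_has_subdivision:
  assumes "finite R" "card Z = s + t - 1" "pairwise (heavy R M) Z"
    and "t \<ge> 3" "(s + t - 1) * (s + t - 1) + (s + t - 1) \<le> M"
  shows "has_subdivision R (L_graph s t)"
proof -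
  define h where "h = s + t - 1"
  have finN: "finite (R `` B)" for B
    using assms(1) by (auto intro: finite_subset[of _ "Range R"] simp: finite_Range)
  have "finite Z"
    using assms(2,4) by (intro card_ge_0_finite) simp
  then obtain f where f: "bij_betw f {0..<h} Z"
    using ex_bij_betw_nat_finite assms(2) unfolding h_def by metis
  define F where "F e = {b. \<forall>v\<in>e. (f v, b) \<in> R} - Z" for e
  have "\<exists>g. inj_on g (snd (L_graph s t)) \<and> (\<forall>e\<in>snd (L_graph s t). g e \<in> F e)"
  proof (rule distinct_representatives)
    fix e assume "e \<in> snd (L_graph s t)"
    then obtain i j where e: "e = {i, j}" "i < h" "j < h" "i \<noteq> j"
      by (auto simp: L_graph_edge_iff h_def)
    then have "f i \<in> Z" "f j \<in> Z" "f i \<noteq> f j"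
      using f by (auto simp: bij_betw_def inj_on_def)
    then have M: "M \<le> card (R `` {f i} \<inter> R `` {f j})"
      using assms(3) by (auto simp: pairwise_def heavy_def)
    have F: "F e = R `` {f i} \<inter> R `` {f j} - Z"
      by (auto simp: F_def e)
    show "finite (F e)"
      unfolding F using finN by blast
    have "card (R `` {f i} \<inter> R `` {f j}) - card Z \<le> card (F e)"
      unfolding F by (rule diff_card_le_card_Diff[OF \<open>finite Z\<close>])
    then show "card (snd (L_graph s t)) \<le> card (F e)"
      using M assms(2,5) card_L_graph_edges[of s t] by linarith
  qed (rule finite_L_graph_edges)
  then obtain g where g: "inj_on g (snd (L_graph s t))"
    "\<And>e. e \<in> snd (L_graph s t) \<Longrightarrow> g e \<in> F e"
    by blast
  show ?thesis
    unfolding has_subdivision_def fst_L_graph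
  proof (intro exI conjI ballI)
    show "inj_on f {0..<s + t - 1}"
      using f by (simp add: bij_betw_def h_def)
  qed (use g f in \<open>auto simp: F_def bij_betw_def h_def\<close>)
qed

text \<open>Any choice of common neighbours works here: a coincidence between two edges would give a
  common neighbour of three branch vertices, one of them in \<open>T\<close>, and non-adjacency
  keeps subdivision vertices apart from branch vertices.\<close>

lemma light_configuration_has_subdivision:
  assumes "irrefl R" "finite T" "finite S" "T \<inter> S = {}" "card T = t - 1" "card S = s" "t \<ge> 3"
    and light: "\<And>x y. x \<in> T \<Longrightarrow> y \<in> T \<union> S \<Longrightarrow> x \<noteq> y \<Longrightarrow> R `` {x} \<inter> R `` {y} \<noteq> {} \<and> (x, y) \<notin> R"
    and triple: "\<And>x y z. x \<in> T \<Longrightarrow> y \<in> T \<union> S \<Longrightarrow> z \<in> T \<union> S \<Longrightarrow> x \<noteq> y \<Longrightarrow> y \<noteq> z \<Longrightarrow> x \<noteq> z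
      \<Longrightarrow> R `` {x} \<inter> R `` {y} \<inter> R `` {z} = {}"
  shows "has_subdivision R (L_graph s t)"
proof -
  define h where "h = s + t - 1"
  have "card {0..<s} = card S" "card {s..<h} = card T"
    using assms(5-7) by (auto simp: h_def)
  then obtain f1 f2 where f1: "bij_betw f1 {0..<s} S" and f2: "bij_betw f2 {s..<h} T"
    using finite_same_card_bij assms(2,3) by (metis finite_atLeastLessThan)
  define f where "f i = (if i < s then f1 i else f2 i)" for i
  have fS: "bij_betw f {0..<s} S"
    using f1 by (subst bij_betw_cong[where g = f1]) (auto simp: f_def)
  have fT: "bij_betw f {s..<h} T"
    using f2 by (subst bij_betw_cong[where g = f2]) (auto simp: f_def)
  have "bij_betw f ({s..<h} \<union> {0..<s}) (T \<union> S)"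
    using fT fS assms(4) by (rule bij_betw_combine)
  moreover have "{s..<h} \<union> {0..<s} = {0..<h}"
    using assms(7) by (auto simp: h_def)
  ultimately have f: "bij_betw f {0..<h} (T \<union> S)"
    by simp
  have fmem: "f i \<in> T \<union> S" if "i < h" for i
    using bij_betwE[OF f] that by simp
  have fmemT: "f i \<in> T" if "i < h" "s \<le> i" for i
    using bij_betwE[OF fT] that by simp
  have finj: "f i = f j \<longleftrightarrow> i = j" if "i < h" "j < h" for i j
    using f that by (auto simp: bij_betw_def inj_on_def)
  define g where "g e = (SOME b. \<forall>v\<in>e. (f v, b) \<in> R)" for e
  have g: "(f v, g e) \<in> R" if "e \<in> snd (L_graph s t)" "v \<in> e" for e v
  proof -
    obtain i j where e: "e = {i, j}" "i < h" "s \<le> i" "j < h" "i \<noteq> j"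
      using \<open>e \<in> snd (L_graph s t)\<close> by (auto simp: L_graph_edge_iff h_def)
    have "\<exists>b. \<forall>v\<in>e. (f v, b) \<in> R"
      using light[of "f i" "f j"] e fmem fmemT finj by auto
    from someI_ex[OF this] show ?thesis
      using that(2) unfolding g_def by blast
  qed
  have "inj_on g (snd (L_graph s t))"
  proof (rule inj_onI, rule ccontr)
    fix e e' assume E: "e \<in> snd (L_graph s t)" "e' \<in> snd (L_graph s t)" "g e = g e'" "e \<noteq> e'"
    obtain i j where e: "e = {i, j}" "i < h" "s \<le> i" "j < h" "i \<noteq> j"
      using E(1) by (auto simp: L_graph_edge_iff h_def)
    obtain i' j' where e': "e' = {i', j'}" "i' < h" "j' < h" "i' \<noteq> j'"
      using E(2) by (auto simp: L_graph_edge_iff h_def)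
    obtain k where k: "k \<in> e'" "k \<notin> e"
      using E(4) e(1,5) e'(1,4) by auto
    then have "k < h" "k \<noteq> i" "k \<noteq> j"
      using e e' by auto
    then have "R `` {f i} \<inter> R `` {f j} \<inter> R `` {f k} = {}"
      using triple[of "f i" "f j" "f k"] e fmem fmemT finj by simp
    moreover have "(f i, g e) \<in> R" "(f j, g e) \<in> R" "(f k, g e) \<in> R"
      using g[OF E(1)] g[OF E(2)] E(3) e(1) k by auto
    ultimately show False
      by blast
  qed
  \<comment> \<open>If \<open>g e\<close> were a branch vertex \<open>f k\<close>, then
    \<open>f k\<close> would be adjacent to the end \<open>f i\<close> of \<open>e\<close> in
    \<open>T\<close>. Irreflexivity excludes \<open>k = i\<close>, and \<open>light\<close> excludes
    the rest.\<close>
  moreover have "g e \<notin> f ` {0..<h}" if "e \<in> snd (L_graph s t)" for e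
  proof
    assume "g e \<in> f ` {0..<h}"
    then obtain k where k: "g e = f k" "k < h"
      by auto
    obtain i j where e: "e = {i, j}" "i < h" "s \<le> i" "j < h" "i \<noteq> j"
      using \<open>e \<in> snd (L_graph s t)\<close> by (auto simp: L_graph_edge_iff h_def)
    have "(f i, f k) \<in> R"
      using g[OF that, of i] e k by simp
    moreover from this have "f i \<noteq> f k"
      using assms(1) by (auto simp: irrefl_def)
    ultimately show False
      using light[of "f i" "f k"] e k fmem fmemT by simp
  qed
  moreover have "inj_on f {0..<h}"
    using f by (simp add: bij_betw_def)
  ultimately show ?thesis
    unfolding has_subdivision_def fst_L_graph h_def[symmetric] using g
    by (intro exI[of _ f] exI[of _ g]) simp
qed

section \<open>Growing the clique part and choosing the independent part\<close>

text \<open>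
  T is the part of the clique chosen so far and U the set of remaining candidates. The
  non-adjacency clause keeps subdivision vertices away from branch vertices, as the graph is not
  assumed bipartite; the clause on triples makes subdivision vertices of different edges distinct.
\<close>

definition linked :: "'a rel \<Rightarrow> nat \<Rightarrow> 'a set \<Rightarrow> 'a set \<Rightarrow> bool" where
  "linked R M T U \<longleftrightarrow> T \<inter> U = {} \<and>
     (\<forall>x\<in>T. \<forall>y\<in>T \<union> U. x \<noteq> y \<longrightarrow> light R M x y \<and> (x, y) \<notin> R) \<and>
     (\<forall>x\<in>T. \<forall>y\<in>T. \<forall>z\<in>T \<union> U. x \<noteq> y \<longrightarrow> y \<noteq> z \<longrightarrow> x \<noteq> z \<longrightarrow>
        R `` {x} \<inter> R `` {y} \<inter> R `` {z} = {})"

lemma linkedD: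
  assumes "linked R M T U"
  shows "T \<inter> U = {}"
    and "\<And>x y. x \<in> T \<Longrightarrow> y \<in> T \<union> U \<Longrightarrow> x \<noteq> y \<Longrightarrow> light R M x y \<and> (x, y) \<notin> R"
    and "\<And>x y z. x \<in> T \<Longrightarrow> y \<in> T \<Longrightarrow> z \<in> T \<union> U \<Longrightarrow> x \<noteq> y \<Longrightarrow> y \<noteq> z \<Longrightarrow> x \<noteq> z \<Longrightarrow>
        R `` {x} \<inter> R `` {y} \<inter> R `` {z} = {}"
  using assms unfolding linked_def by auto

text \<open>Conditions within \<open>insert u T\<close> are inherited, because \<open>u\<close> was
  a candidate; the filter on \<open>U\<close> imposes exactly the new conditions between
  \<open>u\<close> and the remaining candidates.\<close>

lemma linked_insert:
  assumes "linked R M T U" "sym R" "u \<in> U"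
  shows "linked R M (insert u T)
    {v \<in> U. light R M u v \<and> (u, v) \<notin> R \<and> (\<forall>x\<in>T. R `` {x} \<inter> R `` {u} \<inter> R `` {v} = {})}"
    (is "linked R M _ ?U'")
  unfolding linked_def
proof (intro conjI ballI impI)
  note L = linkedD[OF assms(1)]
  show "insert u T \<inter> ?U' = {}"
    using L(1) by (auto simp: light_def)
  have uT: "u \<notin> T"
    using L(1) assms(3) by auto
  fix x y assume xy: "x \<in> insert u T" "y \<in> insert u T \<union> ?U'" "x \<noteq> y"
  have "light R M x y \<and> (x, y) \<notin> R"
  proof (cases "x = u")
    case True
    show ?thesis
    proof (cases "y \<in> T")
      case yT: True
      then have "light R M y u \<and> (y, u) \<notin> R"
        using L(2)[of y u] assms(3) uT by auto
      then show ?thesis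
        using True assms(2) light_sym[of R M] by (auto dest: symD)
    next
      case False
      then show ?thesis
        using True xy by auto
    qed
  next
    case False
    then show ?thesis
      using xy L(2)[of x y] assms(3) by auto
  qed
  then show "light R M x y" "(x, y) \<notin> R"
    by auto
next
  note L = linkedD[OF assms(1)]
  have uT: "u \<notin> T"
    using L(1) assms(3) by auto
  fix x y z assume xyz: "x \<in> insert u T" "y \<in> insert u T" "z \<in> insert u T \<union> ?U'"
    "x \<noteq> y" "y \<noteq> z" "x \<noteq> z"
  \<comment> \<open>For \<open>z\<close> in \<open>T\<close> the triple is reordered so that
    \<open>u\<close> is its third vertex, which is the position allowed to lie in
    \<open>U\<close>.\<close>
  have u: "R `` {w} \<inter> R `` {u} \<inter> R `` {z} = {}" if "w \<in> T" "z \<noteq> w" "z \<noteq> u" for w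
  proof (cases "z \<in> T")
    case True
    then have "R `` {w} \<inter> R `` {z} \<inter> R `` {u} = {}"
      using that uT assms(3) by (intro L(3)) auto
    then show ?thesis
      by blast
  next
    case False
    then show ?thesis
      using that xyz(3) by auto
  qed
  consider "x = u" "y \<in> T" | "y = u" "x \<in> T" | "x \<in> T" "y \<in> T"
    using xyz by auto
  then show "R `` {x} \<inter> R `` {y} \<inter> R `` {z} = {}"
  proof cases
    case 1
    then show ?thesis
      using u[of y] xyz by blast
  next
    case 2
    then show ?thesis
      using u[of x] xyz by blast
  next
    case 3
    then show ?thesis
      using xyz assms(3) by (intro L(3)) auto
  qed
qed

lemma card_Image_le:
  fixes \<Delta> :: real
  assumes "finite S" "\<And>v. real (card (R `` {v})) \<le> \<Delta>"
  shows "real (card (R `` S)) \<le> real (card S) * \<Delta>"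
proof -
  have "card (R `` S) \<le> (\<Sum>v\<in>S. card (R `` {v}))"
    using card_UN_le[OF assms(1), of "\<lambda>v. R `` {v}"] by (simp add: Image_eq_UN[of R S])
  then have "real (card (R `` S)) \<le> (\<Sum>v\<in>S. real (card (R `` {v})))"
    by (simp flip: of_nat_sum)
  also have "\<dots> \<le> (\<Sum>v\<in>S. \<Delta>)"
    using assms(2) by (intro sum_mono)
  finally show ?thesis
    by simp
qed

text \<open>For symmetric \<open>R\<close> this bounds the vertices that share a common neighbour
  with both \<open>x\<close> and \<open>y\<close>, which are the ones to be discarded once
  \<open>x\<close> and \<open>y\<close> are chosen.\<close>

lemma card_Image_light_le:
  fixes \<Delta> :: real
  assumes "finite R" "\<And>v. real (card (R `` {v})) \<le> \<Delta>" "light R M x y" "0 \<le> \<Delta>"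
  shows "real (card (R `` (R `` {x} \<inter> R `` {y}))) \<le> real M * \<Delta>"
proof -
  have "finite (R `` {x} \<inter> R `` {y})"
    using assms(1) by (auto intro: finite_subset[of _ "Range R"] simp: finite_Range)
  then have "real (card (R `` (R `` {x} \<inter> R `` {y}))) \<le> real (card (R `` {x} \<inter> R `` {y})) * \<Delta>"
    by (rule card_Image_le[OF _ assms(2)])
  also have "\<dots> \<le> real M * \<Delta>"
    using assms(3,4) by (intro mult_right_mono) (auto simp: light_def)
  finally show ?thesis .
qed

text \<open>Each step finds \<open>u\<close> with at least \<open>2 * \<gamma> * card U\<close>
  light neighbours in \<open>U\<close>. The discarded ones number at most
  \<open>(h * M + 1) * \<Delta>\<close>, which by \<open>big\<close> is at most half of this, so a
  fraction \<open>\<gamma>\<close> of \<open>U\<close> survives. The 16 in \<open>\<gamma>\<close>,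
  against 8 in \<open>exists_large_light_degree\<close>, reserves that half.\<close>

lemma exists_linked:
  fixes \<delta> \<Delta> :: real
  assumes "finite W" "R \<subseteq> W \<times> W" "sym R" "A \<subseteq> W" "M > 0" "h \<ge> 1" "\<delta> > 0" "\<delta> \<le> \<Delta>"
    and maxdeg: "\<And>v. real (card (R `` {v})) \<le> \<Delta>"
    and mindeg: "\<And>v. v \<in> A \<Longrightarrow> \<delta> \<le> real (card (R `` {v}))"
    and no: "\<And>Z. Z \<subseteq> W \<Longrightarrow> card Z = h \<Longrightarrow> \<not> pairwise (heavy R M) Z"
    and \<gamma>: "\<gamma> = \<delta>\<^sup>2 / (16 * real h * real M * real (card W))"
    and big: "\<And>k. k < N \<Longrightarrow> (real h * real M + 1) * \<Delta> \<le> \<gamma> ^ Suc k * real (card A)"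
    and "N \<le> h"
  shows "\<exists>T U. linked R M T U \<and> T \<subseteq> A \<and> U \<subseteq> A \<and> card T = N \<and> \<gamma> ^ N * real (card A) \<le> real (card U)"
proof -
  have finA: "finite A"
    using assms(1,4) finite_subset by blast
  have finR: "finite R"
    using assms(1,2) by (auto intro: finite_subset)
  have finN: "finite (R `` B)" for B
    using finR by (auto intro: finite_subset[of _ "Range R"] simp: finite_Range)
  have "\<exists>T U. linked R M T U \<and> T \<subseteq> A \<and> U \<subseteq> A \<and> card T = k \<and> \<gamma> ^ k * real (card A) \<le> real (card U)"
    if "k \<le> N" for k
    using that
  proof (induction k)
    case 0
    then show ?case
      by (intro exI[of _ "{}"] exI[of _ A]) (simp add: linked_def)
  next
    case (Suc k)
    then obtain T U where TU: "linked R M T U" "T \<subseteq> A" "U \<subseteq> A" "card T = k"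
      and cU: "\<gamma> ^ k * real (card A) \<le> real (card U)"
      by auto
    have fin: "finite T" "finite U"
      using TU finA finite_subset by auto
    have "\<gamma> \<ge> 0"
      by (simp add: \<gamma>)
    then have \<gamma>U: "\<gamma> ^ Suc k * real (card A) \<le> \<gamma> * real (card U)"
      using mult_left_mono[OF cU] by (simp add: mult.assoc)
    have large: "(real h * real M + 1) * \<Delta> \<le> \<gamma> * real (card U)"
      using big[of k] Suc.prems \<gamma>U by simp
    have hM: "real h * real M \<ge> 1"
      using assms(5,6) by (simp add: Suc_leI flip: of_nat_mult)
    have "0 < (real h * real M + 1) * \<Delta>"
      using hM assms(7,8) by (intro mult_pos_pos) auto
    with large have "\<gamma> * real (card U) > 0"
      by simp
    then have pos: "\<gamma> > 0" "U \<noteq> {}"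
      using \<open>\<gamma> \<ge> 0\<close> by (auto simp: zero_less_mult_iff)
    then have Wpos: "real (card W) > 0"
      using \<gamma> by (cases "card W = 0") auto
    \<comment> \<open>Inserting the value of \<open>\<gamma>\<close> into
      \<open>h * M * \<delta> \<le> \<gamma> * card U\<close> and cancelling one
      \<open>\<delta>\<close> gives more than the required size.\<close>
    have large': "8 * real h * real (card W) \<le> \<delta> * real (card U)"
    proof -
      have "real h * real M * \<delta> \<le> (real h * real M + 1) * \<Delta>"
        using assms(7,8) hM by (intro mult_mono) auto
      then have "real h * real M * \<delta> \<le> \<gamma> * real (card U)"
        using large by simp
      then have "16 * (real h * real M) * (real h * real M) * real (card W) * \<delta> \<le> (\<delta> * real (card U)) * \<delta>"
        unfolding \<gamma> using Wpos assms(5,6) by (simp add: field_simps power2_eq_square)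
      then have "16 * (real h * real M) * (real h * real M) * real (card W) \<le> \<delta> * real (card U)"
        using assms(7) by (simp add: mult_ac)
      moreover have "8 * real h * real (card W) \<le> 16 * (real h * real M) * (real h * real M) * real (card W)"
      proof (intro mult_right_mono)
        have "8 * real h * 1 \<le> 8 * real h * real M"
          using assms(5) by (intro mult_left_mono) auto
        also have "\<dots> \<le> 16 * (real h * real M) * 1"
          by simp
        also have "\<dots> \<le> 16 * (real h * real M) * (real h * real M)"
          using hM by (intro mult_left_mono) auto
        finally show "8 * real h \<le> 16 * (real h * real M) * (real h * real M)"
          by simp
      qed simp
      ultimately show ?thesis
        by (rule order_trans[rotated])
    qed
    have UW: "U \<subseteq> W"
      using TU(3) assms(4) by blast
    have degU: "\<delta> \<le> real (card (R `` {v}))" if "v \<in> U" for v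
      using that TU(3) by (intro mindeg) blast
    have noU: "\<not> pairwise (heavy R M) Z" if "Z \<subseteq> U" "card Z = h" for Z
      using no[of Z] that UW by blast
    have "\<exists>u\<in>U. \<delta>\<^sup>2 * real (card U) / (8 * real h * real M * real (card W))
        \<le> real (card {v \<in> U. light R M u v})"
      by (rule exists_large_light_degree[OF assms(1-3) UW pos(2) assms(5,6) less_imp_le[OF assms(7)]
            degU noU large'])
    then obtain u where u: "u \<in> U" and
      "\<delta>\<^sup>2 * real (card U) / (8 * real h * real M * real (card W)) \<le> real (card {v \<in> U. light R M u v})"
      by blast
    then have L: "2 * (\<gamma> * real (card U)) \<le> real (card {v \<in> U. light R M u v})"
      by (simp add: \<gamma> mult_ac)
    define U' where "U' = {v \<in> U. light R M u v \<and> (u, v) \<notin> R \<and>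
      (\<forall>x\<in>T. R `` {x} \<inter> R `` {u} \<inter> R `` {v} = {})}"
    have linked': "linked R M (insert u T) U'"
      unfolding U'_def by (rule linked_insert[OF TU(1) assms(3) u])
    have uT: "u \<notin> T"
      using linkedD(1)[OF TU(1)] u by auto
    let ?X = "\<Union>x\<in>T. R `` (R `` {x} \<inter> R `` {u})"
    \<comment> \<open>A light neighbour of \<open>u\<close> is lost only if it is adjacent to
      \<open>u\<close> or to a common neighbour of \<open>u\<close> and some \<open>x\<close> in
      \<open>T\<close>.\<close>
    have "{v \<in> U. light R M u v} \<subseteq> U' \<union> (R `` {u} \<union> ?X)"
    proof
      fix v assume v: "v \<in> {v \<in> U. light R M u v}"
      show "v \<in> U' \<union> (R `` {u} \<union> ?X)"
      proof (rule ccontr)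
        assume *: "v \<notin> U' \<union> (R `` {u} \<union> ?X)"
        then obtain x b where "x \<in> T" "(x, b) \<in> R" "(u, b) \<in> R" "(v, b) \<in> R"
          using v by (auto simp: U'_def)
        then have "v \<in> ?X"
          using assms(3) by (auto dest: symD)
        then show False
          using * by blast
      qed
    qed
    then have "card {v \<in> U. light R M u v} \<le> card (U' \<union> (R `` {u} \<union> ?X))"
      using fin finN by (intro card_mono) (auto simp: U'_def)
    also have "\<dots> \<le> card U' + (card (R `` {u}) + card ?X)"
      by (meson card_Un_le order_trans add_left_mono)
    finally have "real (card {v \<in> U. light R M u v}) \<le> real (card U') + real (card (R `` {u})) + real (card ?X)"
      by linarith
    moreover have "real (card ?X) \<le> real h * (real M * \<Delta>)"
    proof -
      have "card ?X \<le> (\<Sum>x\<in>T. card (R `` (R `` {x} \<inter> R `` {u})))"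
        by (rule card_UN_le[OF fin(1)])
      then have "real (card ?X) \<le> (\<Sum>x\<in>T. real (card (R `` (R `` {x} \<inter> R `` {u}))))"
        by (simp flip: of_nat_sum)
      also have "\<dots> \<le> (\<Sum>x\<in>T. real M * \<Delta>)"
      proof (rule sum_mono)
        fix x assume "x \<in> T"
        then have "light R M x u"
          using linkedD(2)[OF TU(1), of x u] u uT by auto
        then show "real (card (R `` (R `` {x} \<inter> R `` {u}))) \<le> real M * \<Delta>"
          using card_Image_light_le[OF finR maxdeg] assms(7,8) by simp
      qed
      also have "\<dots> = real k * (real M * \<Delta>)"
        by (simp add: TU(4))
      also have "\<dots> \<le> real h * (real M * \<Delta>)"
        using Suc.prems assms(7,8,14) by (intro mult_right_mono) auto
      finally show ?thesis .
    qed
    ultimately have "2 * (\<gamma> * real (card U)) \<le> real (card U') + (real h * real M + 1) * \<Delta>"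
      using L maxdeg[of u] by (simp add: algebra_simps)
    then have "\<gamma> ^ Suc k * real (card A) \<le> real (card U')"
      using large \<gamma>U by linarith
    moreover have "insert u T \<subseteq> A" "U' \<subseteq> A" "card (insert u T) = Suc k"
      using TU u uT fin by (auto simp: U'_def)
    ultimately show ?case
      using linked' by blast
  qed
  then show ?thesis
    by blast
qed

text \<open>Vertices of \<open>S\<close> are picked one by one from \<open>U\<close>. Each of the at
  most \<open>h * h\<close> pairs in \<open>T \<times> S\<close> rules out at most
  \<open>M * \<Delta>\<close> vertices, and at most \<open>h\<close> are already taken. Nothing is
  asked of pairs inside \<open>S\<close> alone, as these are not joined in L_{s,t}.\<close>

lemma exists_independent_targets:
  fixes \<Delta> :: real
  assumes "finite R" "sym R" "linked R M T U" "finite T" "finite U" "card T \<le> h" "s \<le> h" "0 \<le> \<Delta>"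
    and maxdeg: "\<And>v. real (card (R `` {v})) \<le> \<Delta>"
    and large: "real h + real h * real h * real M * \<Delta> < real (card U)"
  shows "\<exists>S\<subseteq>U. card S = s \<and> (\<forall>x\<in>T. \<forall>y\<in>S. \<forall>z\<in>S. y \<noteq> z \<longrightarrow> R `` {x} \<inter> R `` {y} \<inter> R `` {z} = {})"
proof -
  have finN: "finite (R `` B)" for B
    using assms(1) by (auto intro: finite_subset[of _ "Range R"] simp: finite_Range)
  show ?thesis
    using assms(7)
  proof (induction s)
    case 0
    then show ?case
      by (intro exI[of _ "{}"]) auto
  next
    case (Suc k)
    then obtain S where S: "S \<subseteq> U" "card S = k"
      and tri: "\<And>x y z. x \<in> T \<Longrightarrow> y \<in> S \<Longrightarrow> z \<in> S \<Longrightarrow> y \<noteq> z \<Longrightarrow> R `` {x} \<inter> R `` {y} \<inter> R `` {z} = {}"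
      by auto
    have finS: "finite S"
      using S assms(5) finite_subset by blast
    let ?X = "\<Union>(x, y)\<in>T \<times> S. R `` (R `` {x} \<inter> R `` {y})"
    have "card ?X \<le> (\<Sum>(x, y)\<in>T \<times> S. card (R `` (R `` {x} \<inter> R `` {y})))"
      using card_UN_le[of "T \<times> S" "\<lambda>(x, y). R `` (R `` {x} \<inter> R `` {y})"] finS assms(4)
      by (simp add: case_prod_unfold)
    then have "real (card ?X) \<le> (\<Sum>(x, y)\<in>T \<times> S. real (card (R `` (R `` {x} \<inter> R `` {y}))))"
      by (simp add: case_prod_unfold flip: of_nat_sum)
    also have "\<dots> \<le> (\<Sum>p\<in>T \<times> S. real M * \<Delta>)"
    proof (rule sum_mono)
      fix p assume "p \<in> T \<times> S"
      then obtain x y where p: "p = (x, y)" "x \<in> T" "y \<in> S"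
        by auto
      then have "light R M x y"
        using linkedD(1,2)[OF assms(3)] S(1) by blast
      then show "(case p of (x, y) \<Rightarrow> real (card (R `` (R `` {x} \<inter> R `` {y})))) \<le> real M * \<Delta>"
        using card_Image_light_le[OF assms(1) maxdeg] assms(8) p by simp
    qed
    also have "\<dots> = (real (card T) * real k) * (real M * \<Delta>)"
      by (simp add: card_cartesian_product S)
    also have "\<dots> \<le> (real h * real h) * (real M * \<Delta>)"
      using assms(6,8) Suc.prems by (intro mult_right_mono mult_mono) auto
    finally have "real (card ?X) \<le> real h * real h * real M * \<Delta>"
      by (simp add: mult.assoc)
    moreover have "card (S \<union> ?X) \<le> card S + card ?X"
      by (rule card_Un_le)
    ultimately have "real (card (S \<union> ?X)) < real (card U)"
      using large S(2) Suc.prems by linarith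
    then have "\<not> U \<subseteq> S \<union> ?X"
      using card_mono[of "S \<union> ?X" U] finS assms(4) finN by force
    then obtain v where v: "v \<in> U" "v \<notin> S" "v \<notin> ?X"
      by blast
    have new: "R `` {x} \<inter> R `` {y} \<inter> R `` {v} = {}" if "x \<in> T" "y \<in> S" for x y
    proof (rule ccontr)
      assume "\<not> ?thesis"
      then obtain b where "(x, b) \<in> R" "(y, b) \<in> R" "(b, v) \<in> R"
        using assms(2) by (auto dest: symD)
      then have "v \<in> ?X"
        using that by blast
      then show False
        using v by blast
    qed
    have "R `` {x} \<inter> R `` {y} \<inter> R `` {z} = {}"
      if "x \<in> T" "y \<in> insert v S" "z \<in> insert v S" "y \<noteq> z" for x y z
    proof -
      consider "y = v" "z \<in> S" | "z = v" "y \<in> S" | "y \<in> S" "z \<in> S"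
        using \<open>y \<in> insert v S\<close> \<open>z \<in> insert v S\<close> \<open>y \<noteq> z\<close> by blast
      then show ?thesis
        using new[of x y] new[of x z] tri[of x y z] that by cases blast+
    qed
    moreover have "insert v S \<subseteq> U" "card (insert v S) = Suc k"
      using S v finS by auto
    ultimately show ?case
      by (intro exI[of _ "insert v S"]) blast
  qed
qed

text \<open>\<open>M\<close> has the value required by \<open>heavy_clique_has_subdivision\<close>.
  The factor of \<open>\<Delta>\<close> in \<open>big\<close> adds up the costs of
  \<open>exists_linked\<close> and of \<open>exists_independent_targets\<close>.\<close>

lemma almost_regular_has_subdivision:
  fixes \<delta> \<Delta> :: real
  assumes "finite W" "R \<subseteq> W \<times> W" "sym R" "irrefl R" "A \<subseteq> W" "t \<ge> 3" "\<delta> > 0" "\<delta> \<le> \<Delta>" "1 \<le> \<Delta>"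
    and h: "h = s + t - 1" and M: "M = h * h + h"
    and maxdeg: "\<And>v. real (card (R `` {v})) \<le> \<Delta>"
    and mindeg: "\<And>v. v \<in> A \<Longrightarrow> \<delta> \<le> real (card (R `` {v}))"
    and \<gamma>: "\<gamma> = \<delta>\<^sup>2 / (16 * real h * real M * real (card W))"
    and big: "\<And>k. k < t - 1 \<Longrightarrow>
      (real h * real h * real M + real h * real M + real h + 1) * \<Delta> \<le> \<gamma> ^ Suc k * real (card A)"
  shows "has_subdivision R (L_graph s t)"
proof (cases "\<exists>Z\<subseteq>W. card Z = h \<and> pairwise (heavy R M) Z")
  case True
  moreover have "finite R"
    using assms(1,2) by (auto intro: finite_subset)
  ultimately show ?thesis
    using heavy_clique_has_subdivision[of R _ s t M] assms(6) h M by auto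
next
  case False
  have finR: "finite R"
    using assms(1,2) by (auto intro: finite_subset)
  have h2: "h \<ge> 2"
    using assms(6) h by simp
  have "(real h * real M + 1) * \<Delta> \<le> (real h * real h * real M + real h * real M + real h + 1) * \<Delta>"
    using assms(9) by (intro mult_right_mono) auto
  then have small: "(real h * real M + 1) * \<Delta> \<le> \<gamma> ^ Suc k * real (card A)" if "k < t - 1" for k
    using big[OF that] by linarith
  have hM: "M > 0" "h \<ge> 1" "t - 1 \<le> h"
    using h h2 M by auto
  have no: "\<not> pairwise (heavy R M) Z" if "Z \<subseteq> W" "card Z = h" for Z
    using False that by blast
  have "\<exists>T U. linked R M T U \<and> T \<subseteq> A \<and> U \<subseteq> A \<and> card T = t - 1 \<and>
      \<gamma> ^ (t - 1) * real (card A) \<le> real (card U)"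
    by (rule exists_linked[OF assms(1-3,5) hM(1,2) assms(7,8) maxdeg mindeg no \<gamma> small hM(3)])
  then obtain T U where TU: "linked R M T U" "T \<subseteq> A" "U \<subseteq> A" "card T = t - 1"
    and cU: "\<gamma> ^ (t - 1) * real (card A) \<le> real (card U)"
    by blast
  have fin: "finite T" "finite U"
    using TU assms(1,5) by (meson finite_subset)+
  have "real h * 1 + real h * real h * real M * \<Delta>
      < (real h * real h * real M + real h * real M + real h + 1) * \<Delta>"
  proof -
    have "real h * 1 \<le> real h * \<Delta>"
      using assms(9) by (rule mult_left_mono) simp
    moreover have "0 \<le> real h * real M * \<Delta>"
      using assms(9) by simp
    ultimately show ?thesis
      using assms(9) unfolding distrib_right by linarith
  qed
  also have "\<dots> \<le> real (card U)"
  proof -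
    have "Suc (t - 2) = t - 1" "t - 2 < t - 1"
      using assms(6) by simp_all
    then show ?thesis
      using big[of "t - 2"] cU by (metis order_trans)
  qed
  finally have large: "real h + real h * real h * real M * \<Delta> < real (card U)"
    by simp
  have le: "card T \<le> h" "s \<le> h" "0 \<le> \<Delta>"
    using TU(4) h assms(6,9) by auto
  have "\<exists>S\<subseteq>U. card S = s \<and> (\<forall>x\<in>T. \<forall>y\<in>S. \<forall>z\<in>S. y \<noteq> z \<longrightarrow>
      R `` {x} \<inter> R `` {y} \<inter> R `` {z} = {})"
    by (rule exists_independent_targets[OF finR assms(3) TU(1) fin le maxdeg large])
  then obtain S where S: "S \<subseteq> U" "card S = s"
    "\<forall>x\<in>T. \<forall>y\<in>S. \<forall>z\<in>S. y \<noteq> z \<longrightarrow> R `` {x} \<inter> R `` {y} \<inter> R `` {z} = {}"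
    by (elim exE conjE)
  note L = linkedD[OF TU(1)]
  show ?thesis
  proof (rule light_configuration_has_subdivision[OF assms(4) fin(1), of S])
    show "finite S" "T \<inter> S = {}" "card T = t - 1" "card S = s" "t \<ge> 3"
      using S fin L(1) TU(4) assms(6) by (auto intro: finite_subset)
    show "R `` {x} \<inter> R `` {y} \<noteq> {} \<and> (x, y) \<notin> R" if "x \<in> T" "y \<in> T \<union> S" "x \<noteq> y" for x y
      using L(2)[of x y] that S(1) by (auto simp: light_def)
    show "R `` {x} \<inter> R `` {y} \<inter> R `` {z} = {}"
      if "x \<in> T" "y \<in> T \<union> S" "z \<in> T \<union> S" "x \<noteq> y" "y \<noteq> z" "x \<noteq> z" for x y z
    \<comment> \<open>With two of the three vertices in \<open>T\<close>, \<open>linked\<close>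
      applies after reordering; otherwise \<open>y\<close> and \<open>z\<close> lie in
      \<open>S\<close> and the choice of \<open>S\<close> applies.\<close>
    proof -
      consider "y \<in> T" | "y \<in> S" "z \<in> T" | "y \<in> S" "z \<in> S"
        using \<open>y \<in> T \<union> S\<close> \<open>z \<in> T \<union> S\<close> by blast
      then show ?thesis
      proof cases
        case 1
        then show ?thesis
          using that S(1) by (intro L(3)) auto
      next
        case 2
        then have "R `` {x} \<inter> R `` {z} \<inter> R `` {y} = {}"
          using that S(1) by (intro L(3)) auto
        then show ?thesis
          by blast
      next
        case 3
        then show ?thesis
          using S(3) that by blast
      qed
    qed
  qed
qed

section \<open>The exponent and the choice of constants\<close>

text \<open>This is where the exponent arises. For \<open>j = k + 1\<close> the claim amounts to
  \<open>Q * a ^ (k + 1) * m ^ k \<le> \<delta> ^ (2 * k + 1)\<close>, which is why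
  \<open>\<delta>\<close> has to be of order \<open>m powr (k / (2 * k + 1))\<close>. The powers of
  \<open>\<delta>\<^sup>2 / (a * m)\<close> are monotone in \<open>j\<close>, so only the extreme
  cases \<open>j = 1\<close> and \<open>j = k + 1\<close> matter.\<close>

lemma geometric_decay_bound:
  fixes \<delta> \<eta> a Q m :: real and j k :: nat
  assumes "1 \<le> m" "1 \<le> a" "1 \<le> Q" "Q * a \<le> \<eta>"
    and \<delta>: "\<eta> * m powr (real k / (2 * real k + 1)) \<le> \<delta>" and "1 \<le> j" "j \<le> k + 1"
  shows "Q * \<delta> \<le> (\<delta>\<^sup>2 / (a * m)) ^ j * m"
proof -
  have Qa: "0 < Q * a"
    using assms(2,3) by simp
  have "m powr (real k / (2 * real k + 1)) \<ge> 1"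
    using assms(1) by (intro ge_one_powr_ge_zero) auto
  then have "\<eta> * 1 \<le> \<eta> * m powr (real k / (2 * real k + 1))"
    using Qa assms(4) by (intro mult_left_mono) auto
  with \<delta> assms(4) have \<delta>Qa: "Q * a \<le> \<delta>"
    by simp
  then have \<delta>0: "\<delta> > 0"
    using Qa by simp
  define \<gamma> where "\<gamma> = \<delta>\<^sup>2 / (a * m)"
  have \<gamma>0: "\<gamma> \<ge> 0"
    using assms(1,2) by (simp add: \<gamma>_def)
  show ?thesis
  proof (cases "\<gamma> \<ge> 1")
    case True
    have "Q * a * \<delta> \<le> \<delta> * \<delta>"
      using \<delta>Qa \<delta>0 by (intro mult_right_mono) auto
    then have "Q * \<delta> \<le> \<gamma> * m"
      using assms(1,2) by (simp add: \<gamma>_def field_simps power2_eq_square)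
    also have "\<dots> \<le> \<gamma> ^ j * m"
      using True assms(1,6) by (intro mult_right_mono self_le_power) auto
    finally show ?thesis
      by (simp add: \<gamma>_def)
  next
    case False
    have mk: "(m powr (real k / (2 * real k + 1))) ^ (2 * k + 1) = m ^ k"
    proof -
      have "(m powr (real k / (2 * real k + 1))) ^ (2 * k + 1)
          = m powr (real (2 * k + 1) * (real k / (2 * real k + 1)))"
        using assms(1) by (intro powr_power) simp
      also have "real (2 * k + 1) * (real k / (2 * real k + 1)) = real k"
        by (simp add: field_simps)
      finally show ?thesis
        using assms(1) by (simp add: powr_realpow)
    qed
    \<comment> \<open>As \<open>Q\<close> and \<open>a\<close> are at least 1, raising them both to
      the power \<open>2 * k + 1\<close> only helps and matches the power of
      \<open>\<eta>\<close>.\<close>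
    have "Q * a ^ (k + 1) \<le> Q ^ (2 * k + 1) * a ^ (2 * k + 1)"
      using assms(2,3) by (intro mult_mono self_le_power power_increasing) auto
    also have "\<dots> = (Q * a) ^ (2 * k + 1)"
      by (simp only: power_mult_distrib)
    also have "\<dots> \<le> \<eta> ^ (2 * k + 1)"
      using Qa assms(4) by (intro power_mono) auto
    finally have "Q * a ^ (k + 1) * m ^ k \<le> \<eta> ^ (2 * k + 1) * m ^ k"
      using assms(1) by (intro mult_right_mono) auto
    also have "\<dots> = (\<eta> * m powr (real k / (2 * real k + 1))) ^ (2 * k + 1)"
      by (simp only: power_mult_distrib mk)
    also have "\<dots> \<le> \<delta> ^ (2 * k + 1)"
      using \<delta> Qa assms(4) by (intro power_mono) auto
    finally have "Q * a ^ (k + 1) * m ^ k * (\<delta> * m) \<le> \<delta> ^ (2 * k + 1) * (\<delta> * m)"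
      using \<delta>0 assms(1) by (intro mult_right_mono) auto
    then have "Q * \<delta> * (a * m) ^ (k + 1) \<le> (\<delta>\<^sup>2) ^ (k + 1) * m"
      by (simp add: power_mult_distrib power_add power_mult[symmetric] power2_eq_square mult_2 mult_2_right mult_ac)
    then have "Q * \<delta> \<le> \<gamma> ^ (k + 1) * m"
      using assms(1,2) by (simp add: \<gamma>_def power_divide field_simps)
    also have "\<dots> \<le> \<gamma> ^ j * m"
      using False \<gamma>0 assms(1,7) by (intro mult_right_mono power_decreasing) auto
    finally show ?thesis
      by (simp add: \<gamma>_def)
  qed
qed

lemma dense_has_subdivision:
  assumes "t \<ge> 3" and \<alpha>: "\<alpha> = (real t - 2) / (2 * real t - 3)"
  shows "\<exists>c::real. c > 0 \<and> (\<forall>(V :: 'a set) R. finite V \<longrightarrow> V \<noteq> {} \<longrightarrow> R \<subseteq> V \<times> V \<longrightarrow> sym R \<longrightarrow>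
    irrefl R \<longrightarrow> c * real (card V) powr (1 + \<alpha>) \<le> real (card R) \<longrightarrow> has_subdivision R (L_graph s t))"
proof -
  define h where "h = s + t - 1"
  define M where "M = h * h + h"
  define q where "q = real h * real h * real M + real h * real M + real h + 1"
  \<comment> \<open>One factor 2592 pays for the maximum degree \<open>2592 * \<delta>\<close>, the
    other for \<open>card W \<le> 2592 * card A\<close>. The density constant
    \<open>4 * (Q * a)\<close> then turns into the factor \<open>Q * a\<close> in the lower bound on
    \<open>\<delta>\<close>.\<close>
  define Q where "Q = 2592 * 2592 * q"
  define a where "a = 16 * real h * real M"
  define k where "k = t - 2"
  have k: "k \<ge> 1" "t - 1 = k + 1" "real t = real k + 2"
    using assms(1) by (auto simp: k_def of_nat_diff)
  have \<alpha>k: "\<alpha> = real k / (2 * real k + 1)"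
    by (simp add: \<alpha> k(3))
  have \<alpha>3: "1 / 3 \<le> \<alpha>"
    using k(1) by (simp add: \<alpha>k field_simps)
  have "h \<ge> 1" "M \<ge> 1"
    using assms(1) by (auto simp: h_def M_def)
  then have a: "a \<ge> 1"
    using mult_mono[of 1 "16 * real h" 1 "real M"] by (simp add: a_def)
  have q: "q \<ge> 1"
    by (simp add: q_def)
  then have Q: "Q \<ge> 2592"
    by (simp add: Q_def)
  have Qa: "Q * a \<ge> 2592"
    using mult_mono[of 2592 Q 1 a] Q a by simp
  have "has_subdivision R (L_graph s t)"
    if V: "finite V" "V \<noteq> {}" "R \<subseteq> V \<times> V" "sym R" "irrefl R"
      and dense: "4 * (Q * a) * real (card V) powr (1 + \<alpha>) \<le> real (card R)"
    for V :: "'a set" and R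
  proof -
    have "648 \<le> 4 * (Q * a)"
      using Qa by simp
    then obtain W R' A \<delta> where W: "finite W" "W \<noteq> {}" "R' \<subseteq> R" "R' \<subseteq> W \<times> W" "sym R'" "A \<subseteq> W"
      and \<delta>: "4 * (Q * a) / 4 * real (card W) powr \<alpha> \<le> \<delta>"
      and maxdeg: "\<And>v. real (card (R' `` {v})) \<le> 2592 * \<delta>"
      and mindeg: "\<And>v. v \<in> A \<Longrightarrow> \<delta> \<le> real (card (R' `` {v}))"
      and A: "real (card W) \<le> 2592 * real (card A)"
    proof (rule dense_almost_regular_subgraph[OF V(1,3,4,2) \<alpha>3 _ dense], goal_cases)
      case 1
      show ?case
        by (rule that[OF 1(2-)])
    qed
    have m: "1 \<le> real (card W)"
      using W(1,2) by (simp add: Suc_leI card_gt_0_iff)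
    then have "real (card W) powr \<alpha> \<ge> 1"
      using \<alpha>3 by (intro ge_one_powr_ge_zero) auto
    then have "Q * a * 1 \<le> Q * a * real (card W) powr \<alpha>"
      using Qa by (intro mult_left_mono) auto
    then have \<delta>1: "\<delta> \<ge> 1"
      using \<delta> Qa by simp
    have Q1: "1 \<le> Q" and \<delta>': "Q * a * real (card W) powr (real k / (2 * real k + 1)) \<le> \<delta>"
      using Q \<delta> unfolding \<alpha>k by simp_all
    define \<gamma> where "\<gamma> = \<delta>\<^sup>2 / (16 * real h * real M * real (card W))"
    have "has_subdivision R' (L_graph s t)"
    proof (rule almost_regular_has_subdivision[OF W(1,4,5) _ W(6) assms(1) _ _ _ h_def M_def maxdeg mindeg \<gamma>_def])
      show "irrefl R'"
        using V(5) W(3) by (auto simp: irrefl_def)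
      show "0 < \<delta>" "\<delta> \<le> 2592 * \<delta>" "1 \<le> 2592 * \<delta>"
        using \<delta>1 by auto
      fix i assume "i < t - 1"
      then have "Suc i \<le> k + 1" and i1: "1 \<le> Suc i"
        using k(2) by simp_all
      from this(1) have "Q * \<delta> \<le> (\<delta>\<^sup>2 / (a * real (card W))) ^ Suc i * real (card W)"
        by (rule geometric_decay_bound[OF m a Q1 order_refl \<delta>' i1])
      then have "Q * \<delta> \<le> \<gamma> ^ Suc i * real (card W)"
        unfolding \<gamma>_def a_def .
      also have "\<dots> \<le> \<gamma> ^ Suc i * (2592 * real (card A))"
        using A by (intro mult_left_mono zero_le_power) (auto simp: \<gamma>_def)
      finally show "(real h * real h * real M + real h * real M + real h + 1) * (2592 * \<delta>)
          \<le> \<gamma> ^ Suc i * real (card A)"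
        unfolding q_def[symmetric] by (simp add: Q_def mult_ac)
    qed
    then show ?thesis
      using W(3) by (rule has_subdivision_mono)
  qed
  moreover have "4 * (Q * a) > 0"
    using Qa by simp
  ultimately show ?thesis
    by blast
qed

section \<open>From relations back to the extremal number\<close>

text \<open>An edge in \<open>H\<close> makes the edgeless graph admissible, so \<open>Max\<close>
  is taken over a non-empty finite set; over an empty set its value would be unspecified.\<close>

lemma ex_attained:
  assumes "snd H \<noteq> {}"
  obtains E where "is_graph ({0..<n}, E)" "\<not> contains_copy ({0..<n}, E) H" "ex n H = card E"
proof -
  let ?S = "{card E | E. is_graph ({0..<n}, E) \<and> \<not> contains_copy ({0..<n}, E) H}"
  have "?S \<subseteq> card ` Pow (Pow {0..<n})"
    by (auto simp: is_graph_def)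
  then have "finite ?S"
    by (rule finite_subset) simp
  moreover have "is_graph ({0..<n}, {})" "\<not> contains_copy ({0..<n}, {}) H"
    using assms by (auto simp: is_graph_def contains_copy_def)
  then have "?S \<noteq> {}"
    by blast
  ultimately have "ex n H \<in> ?S"
    unfolding ex_def by (rule Max_in)
  then show ?thesis
    using that by blast
qed

theorem theorem4:
  fixes s t :: nat
  assumes "s \<ge> 1" and "t \<ge> 3"
  shows "\<exists>C::real. \<forall>n::nat. n > 0 \<longrightarrow>
           real (ex n (L'_graph s t)) \<le> C * real n powr (3/2 - 1 / (4 * real t - 6))"
proof -
  define \<alpha> where "\<alpha> = (real t - 2) / (2 * real t - 3)"
  have exponent: "3/2 - 1 / (4 * real t - 6) = 1 + \<alpha>"
    using assms(2) by (simp add: \<alpha>_def field_simps)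
  obtain c :: real where
    c: "\<And>(V :: nat set) R. \<lbrakk>finite V; V \<noteq> {}; R \<subseteq> V \<times> V; sym R; irrefl R;
      c * real (card V) powr (1 + \<alpha>) \<le> real (card R)\<rbrakk> \<Longrightarrow> has_subdivision R (L_graph s t)"
    using dense_has_subdivision[OF assms(2) \<alpha>_def] by blast
  have "real (ex n (L'_graph s t)) \<le> c * real n powr (1 + \<alpha>)" if "n > 0" for n
  proof (rule ccontr)
    assume large: "\<not> ?thesis"
    obtain v where v: "v \<in> snd (L_graph s t)" "v \<noteq> {}"
      using L_graph_no_isolated[of t s] L_graph_edge_ne assms by (fastforce simp: fst_L_graph)
    then have "snd (L'_graph s t) \<noteq> {}"
      unfolding L'_graph_def subdivision_def by auto
    then obtain E where E: "is_graph ({0..<n}, E)" "\<not> contains_copy ({0..<n}, E) (L'_graph s t)"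
      and card: "ex n (L'_graph s t) = card E"
      by (rule ex_attained)
    define R where "R = {(x, y). {x, y} \<in> E}"
    have edge: "e \<subseteq> {0..<n}" "card e = 2" if "e \<in> E" for e
      using E(1) that by (auto simp: is_graph_def)
    have R: "R \<subseteq> {0..<n} \<times> {0..<n}" "sym R" "irrefl R"
      using edge by (fastforce simp: R_def sym_def irrefl_def insert_commute)+
    \<comment> \<open>Each edge gives two pairs in \<open>R\<close>, but
      \<open>card E \<le> card R\<close> is enough.\<close>
    have "E \<subseteq> (\<lambda>(x, y). {x, y}) ` R"
    proof
      fix e assume e: "e \<in> E"
      then obtain x y where "e = {x, y}"
        using edge(2)[OF e] unfolding card_2_iff by blast
      then show "e \<in> (\<lambda>(x, y). {x, y}) ` R"
        using e by (intro image_eqI[of _ _ "(x, y)"]) (auto simp: R_def)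
    qed
    moreover have "finite R"
      using R(1) by (rule finite_subset) simp
    ultimately have "card E \<le> card R"
      by (rule surj_card_le[rotated])
    then have "c * real (card {0..<n}) powr (1 + \<alpha>) \<le> real (card R)"
      using large card by simp
    then have "has_subdivision R (L_graph s t)"
      using R that by (intro c) auto
    then have "contains_copy ({0..<n}, E) (L'_graph s t)"
      unfolding R_def L'_graph_def
      by (rule has_subdivision_imp_contains_copy[OF E(1) _ L_graph_no_isolated[OF assms(2)] L_graph_edge_ne])
    then show False
      using E(2) by contradiction
  qed
  then show ?thesis
    unfolding exponent by blast
qed

end
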